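(* Let $X,Y,Z,\varphi$ be independent indeterminates over $\mathbb{Q}$ and define $$W_2=(X+Y+Z)^2-12(XY+YZ+ZX),\qquad W_3=(X-Y)(Y-Z)(Z-X),\qquad \mathfrak{W}_3=XYZ-\varphi^3,$$ $$W_4=(X+Y+Z)\big[(X+Y+Z)^3+216XYZ\big],\qquad \mathfrak{W}_4=\varphi\big[27XYZ-(X+Y+Z)^3\big],$$ $$W_6=(X+Y+Z)^6-540XYZ(X+Y+Z)^3-5832X^2Y^2Z^2.$$ Then $$W_2^3-3W_2W_4+2W_6=432W_3^2,$$ and $U:=X+Y+Z$ satisfies $$27U^8-18W_4U^4-8W_6U^2-W_4^2=0\qquad\text{and}\qquad 8U^3\big(W_6^2-W_4^3-1728\mathfrak{W}_4^3\big)=27\,\mathfrak{W}_3\,(W_4-9U^4)^3.$$ *)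

theory Defs
  imports Complex_Main "HOL-Library.Poly_Mapping"
begin

datatype indet = IX | IY | IZ | IPhi

text \<open>The polynomial ring over the rationals in the four indeterminates: finitely supported
  coefficient functions on the monomials, which are finitely supported exponent functions.\<close>

type_synonym qpoly = "(indet \<Rightarrow>\<^sub>0 nat) \<Rightarrow>\<^sub>0 rat"

definition indeterminate :: "indet \<Rightarrow> qpoly" where
  "indeterminate i = Poly_Mapping.single (Poly_Mapping.single i 1) 1"

definition X :: qpoly where "X = indeterminate IX"
definition Y :: qpoly where "Y = indeterminate IY"
definition Z :: qpoly where "Z = indeterminate IZ"
definition \<phi> :: qpoly where "\<phi> = indeterminate IPhi"

definition W2 :: qpoly where
  "W2 = (X + Y + Z)^2 - 12 * (X * Y + Y * Z + Z * X)"

definition W3 :: qpoly where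
  "W3 = (X - Y) * (Y - Z) * (Z - X)"

definition \<WW>3 :: qpoly where
  "\<WW>3 = X * Y * Z - \<phi>^3"

definition W4 :: qpoly where
  "W4 = (X + Y + Z) * ((X + Y + Z)^3 + 216 * X * Y * Z)"

definition \<WW>4 :: qpoly where
  "\<WW>4 = \<phi> * (27 * X * Y * Z - (X + Y + Z)^3)"

definition W6 :: qpoly where
  "W6 = (X + Y + Z)^6 - 540 * X * Y * Z * (X + Y + Z)^3 - 5832 * X^2 * Y^2 * Z^2"

end

theory Submission
  imports Defs
begin

text \<open>Write \<open>U = X + Y + Z\<close>, \<open>P = X Y Z\<close> and \<open>D = 27 P - U\<^sup>3\<close>. Then \<open>W4\<close> and \<open>W6\<close> are
  polynomials in \<open>U\<close> and \<open>P\<close> alone, and the third identity comes from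
  \<open>W4 - 9 U\<^sup>4 = 8 U D\<close> together with \<open>W6\<^sup>2 - W4\<^sup>3 = 1728 P D\<^sup>3\<close>. The first identity says that
  \<open>W3\<^sup>2\<close> is the discriminant of the cubic with roots \<open>X\<close>, \<open>Y\<close>, \<open>Z\<close>.\<close>

lemma discriminant_identity:
  fixes x y z :: "'a::comm_ring_1"
  defines "u \<equiv> x + y + z"
  defines "w2 \<equiv> u^2 - 12 * (x * y + y * z + z * x)"
    and "w4 \<equiv> u * (u^3 + 216 * x * y * z)"
    and "w6 \<equiv> u^6 - 540 * x * y * z * u^3 - 5832 * x^2 * y^2 * z^2"
  shows "w2^3 - 3 * w2 * w4 + 2 * w6 = 432 * ((x - y) * (y - z) * (z - x))^2"
  unfolding w2_def w4_def w6_def u_def by (simp add: algebra_simps eval_nat_numeral)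

text \<open>Nine times the left side is the 3-division polynomial of
  \<open>y^2 = x^3 - 3 * w4 * x - 2 * w6\<close> at \<open>x = 3 * u^2\<close>.\<close>

lemma octic_identity:
  fixes u p :: "'a::comm_ring_1"
  defines "w4 \<equiv> u * (u^3 + 216 * p)" and "w6 \<equiv> u^6 - 540 * p * u^3 - 5832 * p^2"
  shows "27 * u^8 - 18 * w4 * u^4 - 8 * w6 * u^2 - w4^2 = 0"
  unfolding w4_def w6_def by (simp add: algebra_simps eval_nat_numeral)

lemma weight_twelve_identity:
  fixes u p :: "'a::comm_ring_1"
  shows "(u^6 - 540 * p * u^3 - 5832 * p^2)^2 - (u * (u^3 + 216 * p))^3
           = 1728 * p * (27 * p - u^3)^3"
  by (simp add: algebra_simps eval_nat_numeral)

lemma phi_deformation_identity: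
  fixes u p f :: "'a::comm_ring_1"
  defines "w4 \<equiv> u * (u^3 + 216 * p)" and "w6 \<equiv> u^6 - 540 * p * u^3 - 5832 * p^2"
  shows "8 * u^3 * (w6^2 - w4^3 - 1728 * (f * (27 * p - u^3))^3)
           = 27 * (p - f^3) * (w4 - 9 * u^4)^3"
proof -
  have "w4 - 9 * u^4 = 8 * u * (27 * p - u^3)"
    unfolding w4_def by (simp add: algebra_simps eval_nat_numeral)
  moreover have "w6^2 - w4^3 = 1728 * p * (27 * p - u^3)^3"
    unfolding w4_def w6_def by (rule weight_twelve_identity)
  \<comment> \<open>With \<open>D = 27 * p - u^3\<close>, both sides become
    \<open>13824 * u^3 * D^3 * (p - f^3)\<close>, as \<open>8 * 1728 = 27 * 8^3\<close>.\<close>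
  ultimately show ?thesis
    by (simp only:) (simp add: algebra_simps eval_nat_numeral)
qed

theorem theorem3p17:
  shows "W2^3 - 3 * W2 * W4 + 2 * W6 = 432 * W3^2 \<and>
         (let U = X + Y + Z in
            27 * U^8 - 18 * W4 * U^4 - 8 * W6 * U^2 - W4^2 = 0 \<and>
            8 * U^3 * (W6^2 - W4^3 - 1728 * \<WW>4^3) = 27 * \<WW>3 * (W4 - 9 * U^4)^3)"
proof -
  define U P where "U = X + Y + Z" and "P = X * Y * Z"
  have W4: "W4 = U * (U^3 + 216 * P)"
    and W6: "W6 = U^6 - 540 * P * U^3 - 5832 * P^2"
    and WW4: "\<WW>4 = \<phi> * (27 * P - U^3)"
    and WW3: "\<WW>3 = P - \<phi>^3"
    by (simp_all add: W4_def W6_def \<WW>4_def \<WW>3_def U_def P_def power_mult_distrib mult.assoc)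
  \<comment> \<open>\<open>W2\<close> also involves \<open>X * Y + Y * Z + Z * X\<close>, so this
    identity is taken in \<open>X\<close>, \<open>Y\<close>, \<open>Z\<close> instead of
    \<open>U\<close>, \<open>P\<close>.\<close>
  have "W2^3 - 3 * W2 * W4 + 2 * W6 = 432 * W3^2"
    unfolding W2_def W3_def W4_def W6_def by (rule discriminant_identity)
  moreover have "27 * U^8 - 18 * W4 * U^4 - 8 * W6 * U^2 - W4^2 = 0"
    unfolding W4 W6 by (rule octic_identity)
  moreover have "8 * U^3 * (W6^2 - W4^3 - 1728 * \<WW>4^3) = 27 * \<WW>3 * (W4 - 9 * U^4)^3"
    unfolding W4 W6 WW3 WW4 by (rule phi_deformation_identity)
  ultimately show ?thesis
    by (simp add: Let_def U_def)
qed

end
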